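(* Let $k$ be a non-negative integer. The Diophantine equation $$x_1^2+x_2^4+x_3^4+2x_1x_2^2+2x_1x_3^2=kx_1x_2^2x_3^2$$ has a solution $(x_1,x_2,x_3)$ in positive integers if and only if $k=7$. *)

theory Defs
  imports Main
begin

end

theory Submission
  imports Defs
begin

text \<open>
  Write \<open>B = x2\<^sup>2\<close> and \<open>C = x3\<^sup>2\<close>. The equation is monic and quadratic in each of
  \<open>x1\<close>, \<open>B\<close>, \<open>C\<close>, so each of them can be exchanged for the other root of its quadratic
  (Vieta jumping). By the constant terms, the other roots are \<open>(B\<^sup>2 + C\<^sup>2) / x1\<close>,
  \<open>(x1 + C)\<^sup>2 / B\<close> and \<open>(x1 + B)\<^sup>2 / C\<close>. They are again positive integers, and
  the last two are again squares, because their numerators are squares; this is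
  why the special shape of the equation matters.

  A solution that no exchange makes smaller is reduced: \<open>x1\<^sup>2 \<le> B\<^sup>2 + C\<^sup>2\<close>,
  \<open>B \<le> x1 + C\<close> and \<open>C \<le> x1 + B\<close>. By descent every \<open>k\<close> admitting a solution admits
  a reduced one (lemma \<open>ex_reduced_solution\<close>). For reduced solutions the left side
  of the equation is at most \<open>4 x1 B + 3 x1 C + 2 B C\<close> if \<open>B \<ge> C\<close>, while the right
  side has degree three in \<open>x1\<close>, \<open>B\<close>, \<open>C\<close>; this makes the smaller of \<open>B\<close> and \<open>C\<close> tiny unless \<open>x1\<close>
  is tiny. Here it is used once more that \<open>B\<close> and \<open>C\<close> are squares: two different
  squares are far apart, which by \<open>B \<le> x1 + C\<close> forces \<open>x1\<close> to be large. The few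
  remaining cases leave only \<open>k = 7\<close>, coming from \<open>(1, 1, 1)\<close>.
\<close>

definition solution :: "nat \<Rightarrow> nat \<Rightarrow> nat \<Rightarrow> nat \<Rightarrow> bool" where
  "solution k a b c \<longleftrightarrow> 0 < a \<and> 0 < b \<and> 0 < c \<and>
     a ^ 2 + b ^ 4 + c ^ 4 + 2 * a * b ^ 2 + 2 * a * c ^ 2 = k * a * b ^ 2 * c ^ 2"

definition reduced :: "nat \<Rightarrow> nat \<Rightarrow> nat \<Rightarrow> bool" where
  "reduced a b c \<longleftrightarrow> a ^ 2 \<le> b ^ 4 + c ^ 4 \<and> b ^ 2 \<le> a + c ^ 2 \<and> c ^ 2 \<le> a + b ^ 2"

lemma solution_swap: "solution k a b c \<Longrightarrow> solution k a c b"
  unfolding solution_def by (simp add: algebra_simps)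

lemma reduced_swap: "reduced a b c \<Longrightarrow> reduced a c b"
  unfolding reduced_def by (simp add: algebra_simps)

text \<open>The other root of the quadratic in \<open>a\<close> is an integer because \<open>a\<close> divides every
  term of the equation except \<open>b ^ 4 + c ^ 4\<close>.\<close>

lemma jump_first:
  assumes "solution k a b c"
  obtains a' where "a * a' = b ^ 4 + c ^ 4" "solution k a' b c"
proof -
  from assms have pos: "0 < a" "0 < b" "0 < c"
    and eq: "a * (a + 2 * b ^ 2 + 2 * c ^ 2) + (b ^ 4 + c ^ 4) = a * (k * b ^ 2 * c ^ 2)"
    by (auto simp: solution_def algebra_simps power2_eq_square)
  have "a dvd a * (a + 2 * b ^ 2 + 2 * c ^ 2) + (b ^ 4 + c ^ 4)"
    unfolding eq by simp
  hence "a dvd b ^ 4 + c ^ 4" by (subst (asm) dvd_add_right_iff) auto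
  then obtain a' where a': "b ^ 4 + c ^ 4 = a * a'" by (rule dvdE)
  with pos have pos': "0 < a'" by (cases a') auto
  have "a * (a + 2 * b ^ 2 + 2 * c ^ 2 + a') = a * (k * b ^ 2 * c ^ 2)"
    using eq a' by (simp add: algebra_simps)
  with pos have sum: "a + 2 * b ^ 2 + 2 * c ^ 2 + a' = k * b ^ 2 * c ^ 2" by simp
  have "a' ^ 2 + (b ^ 4 + c ^ 4) + 2 * a' * b ^ 2 + 2 * a' * c ^ 2
      = a' * (a + 2 * b ^ 2 + 2 * c ^ 2 + a')"
    unfolding a' by (simp add: algebra_simps power2_eq_square)
  also have "\<dots> = k * a' * b ^ 2 * c ^ 2" unfolding sum by (simp add: algebra_simps)
  finally have "solution k a' b c" using pos pos' by (simp add: solution_def)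
  with a' show thesis by (intro that[of a']) simp_all
qed

text \<open>Here the quadratic in \<open>b\<^sup>2\<close> has the constant term \<open>(a + c\<^sup>2)\<^sup>2\<close>. As this is a
  square, its divisibility by \<open>b\<^sup>2\<close> already gives the divisibility of \<open>a + c\<^sup>2\<close> by \<open>b\<close>,
  and the other root is the square of an integer.\<close>

lemma jump_second:
  assumes "solution k a b c"
  obtains b' where "b * b' = a + c ^ 2" "solution k a b' c"
proof -
  from assms have pos: "0 < a" "0 < b" "0 < c"
    and eq: "b ^ 2 * (b ^ 2 + 2 * a) + (a + c ^ 2) ^ 2 = b ^ 2 * (k * a * c ^ 2)"
    by (auto simp: solution_def algebra_simps power2_eq_square power4_eq_xxxx)
  have "b ^ 2 dvd b ^ 2 * (b ^ 2 + 2 * a) + (a + c ^ 2) ^ 2"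
    unfolding eq by simp
  hence "b ^ 2 dvd (a + c ^ 2) ^ 2" by (subst (asm) dvd_add_right_iff) auto
  hence "b dvd a + c ^ 2" by simp
  then obtain b' where b': "a + c ^ 2 = b * b'" by (rule dvdE)
  with pos have pos': "0 < b'" by (cases b') auto
  have "b ^ 2 * (b ^ 2 + 2 * a + b' ^ 2) = b ^ 2 * (k * a * c ^ 2)"
    using eq unfolding b' by (simp add: algebra_simps)
  with pos have sum: "b ^ 2 + 2 * a + b' ^ 2 = k * a * c ^ 2" by simp
  have "a ^ 2 + b' ^ 4 + c ^ 4 + 2 * a * b' ^ 2 + 2 * a * c ^ 2
      = (a + c ^ 2) ^ 2 + b' ^ 2 * (2 * a + b' ^ 2)"
    by (simp add: algebra_simps power2_eq_square power4_eq_xxxx)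
  also have "\<dots> = b' ^ 2 * (b ^ 2 + 2 * a + b' ^ 2)"
    unfolding b' by (simp add: algebra_simps power2_eq_square)
  also have "\<dots> = k * a * b' ^ 2 * c ^ 2" unfolding sum by (simp add: algebra_simps)
  finally have "solution k a b' c" using pos pos' by (simp add: solution_def)
  with b' show thesis by (intro that[of b']) simp_all
qed

text \<open>Each inequality that fails in \<open>reduced\<close> says that one of the unknowns exceeds the
  root it is exchanged for, so an exchange lowers \<open>a + b + c\<close>.\<close>

lemma ex_reduced_solution:
  assumes "solution k a b c"
  shows "\<exists>a b c. solution k a b c \<and> reduced a b c"
  using assms
proof (induction "a + b + c" arbitrary: a b c rule: less_induct)
  case less
  consider "reduced a b c" | "b ^ 4 + c ^ 4 < a ^ 2" | "a + c ^ 2 < b ^ 2" | "a + b ^ 2 < c ^ 2"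
    unfolding reduced_def by linarith
  thus ?case
  proof cases
    case 1
    with less.prems show ?thesis by blast
  next
    case 2
    obtain a' where a': "a * a' = b ^ 4 + c ^ 4" "solution k a' b c"
      using less.prems by (rule jump_first)
    with 2 have "a * a' < a * a" by (simp add: power2_eq_square)
    hence "a' < a" by simp
    thus ?thesis using less.hyps[of a' b c] a'(2) by simp
  next
    case 3
    obtain b' where b': "b * b' = a + c ^ 2" "solution k a b' c"
      using less.prems by (rule jump_second)
    with 3 have "b * b' < b * b" by (simp add: power2_eq_square)
    hence "b' < b" by simp
    thus ?thesis using less.hyps[of a b' c] b'(2) by simp
  next
    case 4
    obtain c' where c': "c * c' = a + b ^ 2" "solution k a c' b"
      using solution_swap[OF less.prems] by (rule jump_second)
    with 4 have "c * c' < c * c" by (simp add: power2_eq_square)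
    hence "c' < c" by simp
    thus ?thesis using less.hyps[of a b c'] solution_swap[OF c'(2)] by simp
  qed
qed

text \<open>Being reduced bounds each of the squares of \<open>a\<close>, \<open>b\<^sup>2\<close> and \<open>c\<^sup>2\<close> on the left side
  of the equation by products of two different ones of these numbers. Divided by
  \<open>a b\<^sup>2 c\<^sup>2\<close>, the resulting inequality is \<open>1 \<le> 4 / c\<^sup>2 + 3 / b\<^sup>2 + 2 / a\<close>,
  so the unknowns are not all large.\<close>

lemma reduced_bound:
  assumes sol: "solution k a b c" and red: "reduced a b c" and le: "c \<le> b"
  shows "a * b ^ 2 * c ^ 2 \<le> 4 * (a * b ^ 2) + 3 * (a * c ^ 2) + 2 * (b ^ 2 * c ^ 2)"
proof -
  define B C where BC: "B = b ^ 2" "C = c ^ 2"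
  have pos: "0 < a" "0 < B" "0 < C" using sol by (auto simp: solution_def BC)
  have eq: "a * a + B * B + C * C + 2 * a * B + 2 * a * C = k * (a * B * C)"
    using sol by (simp add: solution_def BC power2_eq_square power4_eq_xxxx algebra_simps)
  have CB: "C \<le> B" using le by (simp add: BC power_mono)
  have BaC: "B \<le> a + C" using red by (simp add: reduced_def BC)
  have "a ^ 2 \<le> (B + C) ^ 2"
    using red by (simp add: reduced_def BC power2_eq_square power4_eq_xxxx algebra_simps)
  hence aBC: "a \<le> B + C" by simp
  have "k \<noteq> 0" using eq pos by (intro notI) simp
  hence "a * B * C \<le> k * (a * B * C)" by (cases k) auto
  also have "\<dots> = a * a + B * B + C * C + 2 * a * B + 2 * a * C" using eq by simp
  also have "\<dots> \<le> a * (B + C) + B * (a + C) + C * B + 2 * a * B + 2 * a * C"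
    using aBC BaC CB by (intro add_mono mult_le_mono2 order.refl)
  also have "\<dots> = 4 * (a * B) + 3 * (a * C) + 2 * (B * C)" by (simp add: algebra_simps)
  finally show ?thesis by (simp add: BC)
qed

text \<open>If the smaller square is \<open>1\<close>, then the other square \<open>B\<close> is \<open>a\<close> or \<open>a + 1\<close>. The first
  possibility leads to \<open>a dvd 1\<close>, hence to \<open>k = 7\<close>; the second leads to \<open>a dvd 2\<close>,
  where \<open>B\<close> would be \<open>2\<close> or \<open>3\<close>.\<close>

lemma reduced_one:
  assumes sol: "solution k a b 1" and red: "reduced a b 1"
  shows "k = 7"
proof -
  define B where B: "B = b ^ 2"
  have pos: "0 < a" "0 < B" using sol by (auto simp: solution_def B)
  have eq: "a * a + B * B + 1 + 2 * a * B + 2 * a = k * a * B"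
    using sol by (simp add: solution_def B power2_eq_square power4_eq_xxxx algebra_simps)
  have "B \<le> a + 1" using red by (simp add: reduced_def B)
  moreover have "a \<le> B"
  proof (rule ccontr)
    assume "\<not> a \<le> B"
    hence "(B + 1) * (B + 1) \<le> a * a" by (intro mult_le_mono) auto
    moreover have "a * a \<le> B * B + 1"
      using red by (simp add: reduced_def B power2_eq_square power4_eq_xxxx algebra_simps)
    ultimately show False using pos by simp
  qed
  ultimately consider "B = a" | "B = a + 1" by linarith
  thus ?thesis
  proof cases
    case 1
    have "a * (4 * a + 2) + 1 = a * (k * a)" using eq 1 by (simp add: algebra_simps)
    hence "a dvd a * (4 * a + 2) + 1" by simp
    hence "a dvd 1" by (subst (asm) dvd_add_right_iff) auto
    with eq 1 show ?thesis by simp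
  next
    case 2
    have "(a + 1) * (a * 4 + 2) = (a + 1) * (a * k)"
      using eq 2 by (simp add: algebra_simps)
    hence *: "a * 4 + 2 = a * k" by (simp only: mult_cancel1) simp
    hence "a dvd a * 4 + 2" by simp
    hence "a dvd 2" by (subst (asm) dvd_add_right_iff) auto
    hence "a \<le> 2" by (rule dvd_imp_le) simp
    hence "b ^ 2 = 2 \<or> b ^ 2 = 3" using 2 pos by (auto simp: B)
    moreover have "b ^ 2 \<noteq> 2 \<and> b ^ 2 \<noteq> 3"
    proof (cases "b \<le> 1")
      case True
      hence "b = 0 \<or> b = 1" by linarith
      thus ?thesis by auto
    next
      case False
      hence "2 ^ 2 \<le> b ^ 2" by (intro power_mono) auto
      thus ?thesis by auto
    qed
    ultimately show ?thesis by blast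
  qed
qed

text \<open>Modulo \<open>b\<^sup>2\<close> the equation reads \<open>a\<^sup>2 = 0\<close>, so \<open>a \<ge> b\<close>, and then \<open>reduced_bound\<close>
  leaves only \<open>b = 2\<close> and \<open>b = 3\<close>.\<close>

lemma no_reduced_equal:
  assumes sol: "solution k a b b" and red: "reduced a b b" and b2: "2 \<le> b"
  shows False
proof -
  have pos: "0 < a" using sol by (simp add: solution_def)
  have eq: "b ^ 2 * (2 * b ^ 2 + 4 * a) + a ^ 2 = b ^ 2 * (k * a * b ^ 2)"
    using sol by (simp add: solution_def power2_eq_square power4_eq_xxxx algebra_simps)
  hence "b ^ 2 dvd b ^ 2 * (2 * b ^ 2 + 4 * a) + a ^ 2" by simp
  hence "b ^ 2 dvd a ^ 2" by (subst (asm) dvd_add_right_iff) auto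
  hence "b dvd a" by simp
  then obtain m where m: "a = b * m" by (rule dvdE)
  with pos have m0: "0 < m" by (cases m) auto
  with m have "b \<le> a" by simp
  have "b ^ 2 * (a * b ^ 2) \<le> b ^ 2 * (7 * a + 2 * b ^ 2)"
    using reduced_bound[OF sol red] by (simp add: algebra_simps)
  with b2 have bound: "a * b ^ 2 \<le> 7 * a + 2 * b ^ 2" by simp
  have "b < 4"
  proof (rule ccontr)
    assume "\<not> b < 4"
    hence "4 ^ 2 \<le> b ^ 2" by (intro power_mono) auto
    then obtain r where r: "b ^ 2 = 16 + r" by (auto simp: le_iff_add)
    from \<open>b \<le> a\<close> \<open>\<not> b < 4\<close> obtain s where "a = 4 + s" by (auto simp: le_iff_add not_less)
    with r bound show False by (simp add: algebra_simps)
  qed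
  with b2 consider "b = 2" | "b = 3" by linarith
  thus False
  proof cases
    case 1
    have "m ^ 2 < 3 ^ 2" using red 1 m by (simp add: reduced_def power_mult_distrib)
    hence "m < 3" by (rule power_less_imp_less_base) simp
    with m0 consider "m = 1" | "m = 2" by linarith
    thus False using eq 1 m by cases (simp_all, presburger+)
  next
    case 2
    with bound m have "m \<le> 3" by simp
    with m0 consider "m = 1" | "m = 2" | "m = 3" by linarith
    thus False using eq 2 m by cases (simp_all, presburger+)
  qed
qed

text \<open>Different squares \<open>b\<^sup>2\<close> and \<open>c\<^sup>2\<close> are at least \<open>2 c + 1\<close> apart, so \<open>a \<ge> 2 c + 1\<close> and
  \<open>reduced_bound\<close> leaves only \<open>c = 2\<close>. Then \<open>a = b\<^sup>2 - d\<close> with \<open>d \<le> 4\<close>, and \<open>a\<close> divides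
  \<open>b ^ 4 + c ^ 4\<close>, hence also \<open>d\<^sup>2 + 16\<close>; so finitely many cases remain.\<close>

lemma no_reduced_distinct:
  assumes sol: "solution k a b c" and red: "reduced a b c" and c2: "2 \<le> c" and lt: "c < b"
  shows False
proof -
  have "(c + 1) ^ 2 \<le> b ^ 2" using lt by (intro power_mono) auto
  hence gap: "c ^ 2 + 2 * c + 1 \<le> b ^ 2" by (simp add: power2_eq_square)
  moreover have Ba: "b ^ 2 \<le> a + c ^ 2" using red by (simp add: reduced_def)
  ultimately have a: "2 * c + 1 \<le> a" by simp
  have "c < 3"
  proof (rule ccontr)
    assume "\<not> c < 3"
    hence "3 ^ 2 \<le> c ^ 2" by (intro power_mono) auto
    then obtain r where r: "c ^ 2 = 9 + r" by (auto simp: le_iff_add)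
    from gap r \<open>\<not> c < 3\<close> have "16 + r \<le> b ^ 2" by linarith
    then obtain t where t: "b ^ 2 = 16 + r + t" by (auto simp: le_iff_add)
    from a \<open>\<not> c < 3\<close> have "7 \<le> a" by linarith
    then obtain s where s: "a = 7 + s" by (auto simp: le_iff_add)
    \<comment> \<open>In \<open>r\<close>, \<open>s\<close>, \<open>t\<close> the difference of the two sides has only nonnegative coefficients
      and the constant term \<open>83\<close>.\<close>
    from reduced_bound[OF sol red less_imp_le[OF lt]] show False
      unfolding r s t by (simp add: algebra_simps)
  qed
  with c2 have c: "c = 2" by simp
  define B where B: "B = b ^ 2"
  have "3 ^ 2 \<le> B" unfolding B using lt c by (intro power_mono) auto
  hence B9: "9 \<le> B" by simp
  have eq: "a * a + B * B + 16 + 2 * a * B + 8 * a = 4 * k * a * B"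
    using sol by (simp add: solution_def B c power2_eq_square power4_eq_xxxx algebra_simps)
  have "a \<le> B"
  proof (rule ccontr)
    assume "\<not> a \<le> B"
    hence "(B + 1) * (B + 1) \<le> a * a" by (intro mult_le_mono) auto
    moreover have "a * a \<le> B * B + 16"
      using red by (simp add: reduced_def B c power2_eq_square power4_eq_xxxx algebra_simps)
    ultimately show False using B9 by simp
  qed
  then obtain d where d: "B = a + d" by (auto simp: le_iff_add)
  have d4: "d \<le> 4" using Ba d c by (simp add: B)
  have "a * (4 * a + 4 * d + 8) + (d * d + 16) = a * (4 * k * B)"
    using eq unfolding d by (simp add: algebra_simps)
  hence "a dvd a * (4 * a + 4 * d + 8) + (d * d + 16)" by simp
  hence dvd: "a dvd d * d + 16" by (subst (asm) dvd_add_right_iff) auto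
  hence "a \<le> d * d + 16" by (rule dvd_imp_le) simp
  moreover have "d * d \<le> 4 * 4" using d4 by (intro mult_le_mono)
  ultimately have "B < 7 ^ 2" using d d4 by simp
  hence "b < 7" unfolding B by (rule power_less_imp_less_base) simp
  hence b: "b \<in> {3, 4, 5, 6}" using lt c by auto
  have dd: "d \<in> {0, 1, 2, 3, 4}" using d4 by auto
  have "a = b ^ 2 - d" using d B by simp
  with dvd have "b ^ 2 - d dvd d * d + 16" by simp
  with b dd have "b = 4 \<and> d = 0 \<or> b = 6 \<and> d = 4" by auto
  hence "a = 16 \<and> B = 16 \<or> a = 32 \<and> B = 36" using d by (auto simp: B)
  thus False
  proof
    assume "a = 16 \<and> B = 16"
    with eq have "1168 = 1024 * k" by simp
    hence "1024 dvd (1168 :: nat)" by (rule dvdI)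
    thus False by simp
  next
    assume "a = 32 \<and> B = 36"
    with eq have "4896 = 4608 * k" by simp
    hence "4608 dvd (4896 :: nat)" by (rule dvdI)
    thus False by simp
  qed
qed

lemma reduced_imp_seven_ordered:
  assumes sol: "solution k a b c" and red: "reduced a b c" and le: "c \<le> b"
  shows "k = 7"
proof -
  have "0 < c" using sol by (simp add: solution_def)
  then consider "c = 1" | "2 \<le> c" "b = c" | "2 \<le> c" "c < b" using le by linarith
  thus ?thesis
  proof cases
    case 1
    with sol red reduced_one show ?thesis by simp
  next
    case 2
    with sol red no_reduced_equal show ?thesis by blast
  next
    case 3
    with sol red no_reduced_distinct show ?thesis by blast
  qed
qed

lemma reduced_imp_seven:
  assumes "solution k a b c" "reduced a b c"
  shows "k = 7"
proof (cases "c \<le> b")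
  case True
  with assms show ?thesis by (rule reduced_imp_seven_ordered)
next
  case False
  hence "b \<le> c" by simp
  with solution_swap[OF assms(1)] reduced_swap[OF assms(2)] show ?thesis
    by (rule reduced_imp_seven_ordered)
qed

theorem theorem1p4:
  fixes k :: nat
  shows "(\<exists>x1 x2 x3 :: nat. 0 < x1 \<and> 0 < x2 \<and> 0 < x3 \<and>
            x1 ^ 2 + x2 ^ 4 + x3 ^ 4 + 2 * x1 * x2 ^ 2 + 2 * x1 * x3 ^ 2
              = k * x1 * x2 ^ 2 * x3 ^ 2)
         \<longleftrightarrow> k = 7"
proof
  assume "\<exists>x1 x2 x3 :: nat. 0 < x1 \<and> 0 < x2 \<and> 0 < x3 \<and>
            x1 ^ 2 + x2 ^ 4 + x3 ^ 4 + 2 * x1 * x2 ^ 2 + 2 * x1 * x3 ^ 2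
              = k * x1 * x2 ^ 2 * x3 ^ 2"
  then obtain a b c where "solution k a b c" unfolding solution_def by blast
  then obtain a' b' c' where "solution k a' b' c'" "reduced a' b' c'"
    using ex_reduced_solution by blast
  thus "k = 7" by (rule reduced_imp_seven)
next
  assume "k = 7"
  hence "solution k 1 1 1" by (simp add: solution_def)
  thus "\<exists>x1 x2 x3 :: nat. 0 < x1 \<and> 0 < x2 \<and> 0 < x3 \<and>
            x1 ^ 2 + x2 ^ 4 + x3 ^ 4 + 2 * x1 * x2 ^ 2 + 2 * x1 * x3 ^ 2
              = k * x1 * x2 ^ 2 * x3 ^ 2"
    unfolding solution_def by blast
qed

end
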